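(* Let $N\ge2$. All holomorphic rational proper maps from the unit disk $\Delta$ to the unit ball $\mathbb{B}_N$ belong to one homotopy equivalence class: for any two holomorphic rational proper maps $F,G:\Delta\to\mathbb{B}_N$, the maps $F$ and $G$ are homotopic in target dimension $N$. Thus $h(1,N)=1$ for $N\ge2$.
   Context: $\Delta=\mathbb{B}_1$ is the open unit disk in $\mathbb{C}$ and $\mathbb{B}_N$ is the open unit ball in $\mathbb{C}^N$. Proper holomorphic maps $f:\mathbb{B}_n\to\mathbb{B}_{N_f}$ and $g:\mathbb{B}_n\to\mathbb{B}_{N_g}$ are homotopic in target dimension $N$ if there is a one-parameter family of proper holomorphic maps $H_t:\mathbb{B}_n\to\mathbb{B}_N$, $t\in[0,1]$, with $(z,t)\mapsto H_t(z)$ continuous, $H_0=f\oplus0$ and $H_1=g\oplus0$, where $f\oplus 0$ denotes $f$ followed by the number of zero components needed to land in $\mathbb{C}^N$. $\mathcal{H}(n,N)$ is the set of homotopy equivalence classes (in target dimension $N$) of rational proper holomorphic maps from $\mathbb{B}_n$ to $\mathbb{B}_N$, and $h(n,N)$ is its cardinality. *)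

theory Defs
  imports "HOL-Analysis.Analysis"
begin

text \<open>
  \<open>\<complex>\<^sup>n\<close> is rendered as \<open>complex^'n\<close> with \<open>n = CARD('n)\<close>; its norm is the
  Euclidean one, so the unit ball of \<open>\<complex>\<^sup>n\<close> is \<open>ball 0 1\<close> and the unit disk is
  the unit ball of \<open>complex^1\<close>. Maps are total HOL functions of which only the
  values on \<open>ball 0 1\<close> are relevant.
\<close>

text \<open>Holomorphy in several variables: complex Frechet differentiability.\<close>

definition holomorphic_map_on :: "(complex^'n \<Rightarrow> complex^'m) \<Rightarrow> (complex^'n) set \<Rightarrow> bool"
  where "holomorphic_map_on f S \<longleftrightarrow>
    (\<forall>z\<in>S. \<exists>f'. (f has_derivative f') (at z within S) \<and> (\<forall>c v. f' (c *s v) = c *s f' v))"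

text \<open>
  \<open>proper_map\<close> means closed with compact fibres and includes that the ball is mapped into
  the ball; for continuous maps between balls this is compactness of preimages of compact sets.
\<close>

definition proper_holomorphic_ball_map :: "(complex^'n \<Rightarrow> complex^'m) \<Rightarrow> bool"
  where "proper_holomorphic_ball_map f \<longleftrightarrow>
    holomorphic_map_on f (ball 0 1) \<and>
    proper_map (top_of_set (ball 0 1)) (top_of_set (ball 0 1)) f"

inductive complex_polynomial_function :: "(complex^'n \<Rightarrow> complex) \<Rightarrow> bool"
  where
    const: "complex_polynomial_function (\<lambda>z. c)"
  | coord: "complex_polynomial_function (\<lambda>z. z $ i)"
  | add: "complex_polynomial_function p \<Longrightarrow> complex_polynomial_function q \<Longrightarrow>
            complex_polynomial_function (\<lambda>z. p z + q z)"
  | mult: "complex_polynomial_function p \<Longrightarrow> complex_polynomial_function q \<Longrightarrow>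
            complex_polynomial_function (\<lambda>z. p z * q z)"

text \<open>
  The components are quotients of polynomials with a common denominator. A holomorphic
  map with rational components has, in lowest terms, a denominator without zeros in the
  ball, so the condition \<open>q z \<noteq> 0\<close> is no restriction.
\<close>

definition rational_on_ball :: "(complex^'n \<Rightarrow> complex^'m) \<Rightarrow> bool"
  where "rational_on_ball f \<longleftrightarrow>
    (\<exists>p q. (\<forall>i. complex_polynomial_function (p i)) \<and> complex_polynomial_function q \<and>
      (\<forall>z\<in>ball 0 1. q z \<noteq> 0 \<and> (\<forall>i. f z $ i = p i z / q z)))"

definition rational_proper_ball_map :: "(complex^'n \<Rightarrow> complex^'m) \<Rightarrow> bool"
  where "rational_proper_ball_map f \<longleftrightarrow> proper_holomorphic_ball_map f \<and> rational_on_ball f"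

text \<open>
  \<open>v \<oplus> 0\<close>, for \<open>CARD('k) \<le> CARD('m)\<close>. The order of the components is given by the
  fixed enumeration \<open>to_nat_on UNIV\<close> of a finite index type by \<open>{..<CARD('k)}\<close>.
\<close>

definition zero_pad :: "complex^'k \<Rightarrow> complex^'m"
  where "zero_pad v = (\<chi> i. let j = to_nat_on (UNIV :: 'm set) i in
    if j < CARD('k) then v $ from_nat_into UNIV j else 0)"

lemma zero_pad_same [simp]: "zero_pad v = (v :: complex^'m)"
proof -
  have "to_nat_on UNIV i < CARD('m)" for i :: 'm
    using to_nat_on_finite[of "UNIV :: 'm set"] by (auto simp: bij_betw_def)
  then show ?thesis
    by (simp add: zero_pad_def vec_eq_iff Let_def uncountable_def countable_finite)
qed

definition homotopic_in_target ::
    "'m::finite itself \<Rightarrow> (complex^'n \<Rightarrow> complex^'k) \<Rightarrow> (complex^'n \<Rightarrow> complex^'l) \<Rightarrow> bool"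
  where "homotopic_in_target (_ :: 'm::finite itself) f g \<longleftrightarrow>
    CARD('k) \<le> CARD('m) \<and> CARD('l) \<le> CARD('m) \<and>
    (\<exists>H :: real \<Rightarrow> complex^'n \<Rightarrow> complex^'m.
      (\<forall>t\<in>{0..1}. proper_holomorphic_ball_map (H t)) \<and>
      continuous_on (ball 0 1 \<times> {0..1}) (\<lambda>(z, t). H t z) \<and>
      (\<forall>z\<in>ball 0 1. H 0 z = zero_pad (f z)) \<and>
      (\<forall>z\<in>ball 0 1. H 1 z = zero_pad (g z)))"

text \<open>
  The set of homotopy classes \<open>\<H>(n, N)\<close>. Functions that agree on the ball are homotopic,
  so values outside the ball do not create additional classes.
\<close>

definition homotopy_classes :: "'n::finite itself \<Rightarrow> 'm::finite itself \<Rightarrow> (complex^'n \<Rightarrow> complex^'m) set set"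
  where "homotopy_classes _ _ =
    {f. rational_proper_ball_map f} //
    {(f, g). rational_proper_ball_map f \<and> rational_proper_ball_map g \<and>
             homotopic_in_target TYPE('m) f g}"

text \<open>By the convention for \<open>card\<close>, the value is \<open>0\<close> if there are infinitely many classes.\<close>

definition num_homotopy_classes :: "'n::finite itself \<Rightarrow> 'm::finite itself \<Rightarrow> nat"
  where "num_homotopy_classes n m = card (homotopy_classes n m)"

end

theory Submission
  imports Defs "HOL-Computational_Algebra.Polynomial"
begin

text \<open>
  Every rational proper map \<open>F\<close> is joined to a linear map \<open>z \<mapsto> z u\<close> with \<open>u\<close> a unit vector, and
  the linear maps are joined to each other along paths in the unit sphere, which is connected.

  The tool is the family of disk automorphisms \<open>m\<^sub>a(w) = (w + a) / (1 + cnj a * w)\<close> with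
  \<open>\<bar>a\<bar> < 1\<close>: \<open>m\<^sub>0\<close> is the identity, and if \<open>a\<close> tends to a point \<open>\<zeta>\<close> of the unit circle,
  then \<open>m\<^sub>a\<close> tends to the constant \<open>\<zeta>\<close>, locally uniformly on the open disk. Being locally
  uniform on the open disk is precisely what joint continuity in \<open>(z, t)\<close> requires.
  This is used twice.

  \<^item> The maps \<open>m\<^sub>t(z) F(z)\<close>, \<open>0 \<le> t \<le> 1\<close>, are proper, since both \<open>\<bar>m\<^sub>t\<bar>\<close> and the norm of \<open>F\<close> tend
    to \<open>1\<close> at the unit circle. They lead from \<open>z F(z)\<close> to \<open>F(z)\<close>
    (\<open>proper_homotopic_times_coordinate\<close>).
  \<^item> Choose \<open>\<zeta>\<close> on the circle outside the finite zero set of the denominator of \<open>F\<close>, so that \<open>F\<close>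
    is continuous at \<open>\<zeta>\<close>; properness forces \<open>u = F(\<zeta>)\<close> to be a unit vector. The maps
    \<open>z F(m\<^sub>a(z))\<close> with \<open>a = t \<zeta>\<close> lead from \<open>z F(z)\<close> to \<open>z u\<close>; the factor \<open>z\<close> keeps the final
    map proper although \<open>F(m\<^sub>a(z))\<close> degenerates to a constant
    (\<open>proper_homotopic_linear_limit\<close>).

  The first step thus creates the factor \<open>z\<close> that the second one needs. Properness is
  checked throughout in the form of \<open>proper_map_ball_iff\<close>: the norm of the map tends to \<open>1\<close> at
  the boundary of the ball.
\<close>

section \<open>Properness of maps between balls\<close>

text \<open>
  The filter of approach to the unit sphere from inside the ball. With it, the boundary
  behavior of products and of compositions follows from the limit rules for filters.
\<close>

definition ball_boundary :: "'a::real_normed_vector filter"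
  where "ball_boundary = filtercomap norm (at_left 1)"

lemma tendsto_norm_ball_boundary: "(norm \<longlongrightarrow> 1) ball_boundary"
  unfolding ball_boundary_def
  by (rule filterlim_compose[OF _ filterlim_filtercomap]) (simp add: filterlim_at_split at_within_le_nhds filterlim_def)

lemma eventually_ball_boundary:
  "eventually P ball_boundary \<longleftrightarrow> (\<exists>r<1. \<forall>z. r < norm z \<longrightarrow> norm z < 1 \<longrightarrow> P z)"
proof -
  have "eventually P ball_boundary \<longleftrightarrow>
      (\<exists>Q. (\<exists>r<1. \<forall>y>r. y < 1 \<longrightarrow> Q y) \<and> (\<forall>z. Q (norm z) \<longrightarrow> P z))"
    by (simp add: ball_boundary_def eventually_filtercomap eventually_at_left_field)
  also have "\<dots> \<longleftrightarrow> (\<exists>r<1. \<forall>z. r < norm z \<longrightarrow> norm z < 1 \<longrightarrow> P z)"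
  proof (intro iffI; clarify)
    fix r :: real assume "r < 1" "\<forall>z. r < norm z \<longrightarrow> norm z < 1 \<longrightarrow> P z"
    then show "\<exists>Q. (\<exists>r<1. \<forall>y>r. y < 1 \<longrightarrow> Q y) \<and> (\<forall>z. Q (norm z) \<longrightarrow> P z)"
      by (intro exI[of _ "\<lambda>y. r < y \<and> y < 1"]) auto
  qed blast
  finally show ?thesis .
qed

lemma eventually_in_ball_ball_boundary: "eventually (\<lambda>z. z \<in> ball 0 1) ball_boundary"
  by (auto simp: eventually_ball_boundary intro: exI[of _ 0])

lemma filterlim_ball_boundary:
  assumes "((\<lambda>x. norm (f x)) \<longlongrightarrow> 1) F" "eventually (\<lambda>x. f x \<in> ball 0 1) F"
  shows "filterlim f ball_boundary F"
  using assms unfolding ball_boundary_def filterlim_filtercomap_iff o_def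
  by (intro tendsto_imp_filterlim_at_left) auto

lemma holomorphic_map_on_imp_continuous_on:
  "holomorphic_map_on f S \<Longrightarrow> continuous_on S f"
  unfolding holomorphic_map_on_def
  by (meson continuous_on_eq_continuous_within has_derivative_continuous)

lemma compact_subset_ball_norm_bound:
  fixes C :: "'a::real_normed_vector set"
  assumes "compact C" "C \<subseteq> ball 0 1"
  obtains r where "r < 1" "\<And>z. z \<in> C \<Longrightarrow> norm z \<le> r"
proof (cases "C = {}")
  case True then show thesis using that[of 0] by simp
next
  case False
  obtain w where "w \<in> C" "\<And>z. z \<in> C \<Longrightarrow> norm z \<le> norm w"
    using continuous_attains_sup[OF assms(1) False continuous_on_norm_id] by blast
  then show thesis using that[of "norm w"] assms(2) by auto
qed

text \<open>
  A compact subset of the ball stays away from the sphere. Hence compact preimages say that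
  \<open>f\<close> leaves every smaller ball as its argument approaches the sphere, and conversely the
  preimage of a compact set is then closed in some smaller closed ball.
\<close>

lemma proper_map_ball_iff:
  fixes f :: "'a::euclidean_space \<Rightarrow> 'b::euclidean_space"
  assumes cont: "continuous_on (ball 0 1) f"
  shows "proper_map (top_of_set (ball 0 1)) (top_of_set (ball 0 1)) f \<longleftrightarrow>
    (\<forall>z\<in>ball 0 1. norm (f z) < 1) \<and> ((\<lambda>z. norm (f z)) \<longlongrightarrow> 1) ball_boundary"
    (is "?proper \<longleftrightarrow> ?maps \<and> ?lim")
proof -
  let ?pre = "\<lambda>K. {z \<in> ball 0 1. f z \<in> K}"
  have proper_iff: "?proper \<longleftrightarrow>
      ?maps \<and> (\<forall>K\<subseteq>ball 0 1. compact K \<longrightarrow> compact (?pre K))"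
  proof (cases ?maps)
    case True
    then have "f \<in> ball 0 1 \<rightarrow> ball 0 1" by auto
    have "?proper \<longleftrightarrow> f \<in> ball 0 1 \<rightarrow> ball 0 1 \<and>
      (\<forall>K. compactin (top_of_set (ball 0 1)) K \<longrightarrow> compactin (top_of_set (ball 0 1)) (?pre K))"
      by (subst proper_eq_compact_map)
        (use cont in \<open>auto simp: metrizable_imp_k_space kc_space_subtopology kc_space_euclidean
           metrizable_space_subtopology metrizable_space_euclidean\<close>)
    then show ?thesis
      using True \<open>f \<in> ball 0 1 \<rightarrow> ball 0 1\<close> by (auto simp: compactin_subtopology)
  next
    case False
    then show ?thesis
      using proper_map_imp_subset_topspace[of "top_of_set (ball 0 1)" "top_of_set (ball 0 1)" f] by fastforce
  qed
  have compact_iff: "?lim \<longleftrightarrow> (\<forall>K\<subseteq>ball 0 1. compact K \<longrightarrow> compact (?pre K))" if maps: ?maps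
  proof
    assume lim: ?lim
    show "\<forall>K\<subseteq>ball 0 1. compact K \<longrightarrow> compact (?pre K)"
    proof (intro allI impI)
      fix K :: "'b set" assume K: "K \<subseteq> ball 0 1" "compact K"
      obtain s where s: "s < 1" "\<And>w. w \<in> K \<Longrightarrow> norm w \<le> s"
        using compact_subset_ball_norm_bound[OF K(2,1)] by blast
      have "eventually (\<lambda>z. s < norm (f z)) ball_boundary"
        using lim s(1) by (rule order_tendstoD)
      then obtain r where r: "r < 1" "\<And>z. r < norm z \<Longrightarrow> norm z < 1 \<Longrightarrow> s < norm (f z)"
        by (auto simp: eventually_ball_boundary)
      \<comment> \<open>Replacing the open ball by a closed one makes closedness of the preimage absolute.\<close>
      have "?pre K = {z \<in> cball 0 r. f z \<in> K}"
        using r s by (auto simp: not_less[symmetric])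
      moreover have "closed {z \<in> cball 0 r. f z \<in> K}"
        using continuous_closed_preimage[of "cball 0 r" f K] K(2) r(1)
          continuous_on_subset[OF cont, of "cball 0 r"]
        by (auto simp: compact_imp_closed vimage_def Int_def subset_iff)
      ultimately show "compact (?pre K)"
        by (metis (no_types, lifting) bounded_cball bounded_subset compact_eq_bounded_closed mem_Collect_eq subsetI)
    qed
  next
    assume comp: "\<forall>K\<subseteq>ball 0 1. compact K \<longrightarrow> compact (?pre K)"
    show ?lim
    proof (rule order_tendstoI)
      fix s :: real assume "s < 1"
      have "compact (?pre (cball 0 s))"
        using comp[rule_format, of "cball 0 s"] \<open>s < 1\<close> by (auto simp: subset_iff)
      moreover have "?pre (cball 0 s) \<subseteq> ball 0 1" by blast
      ultimately obtain r where r: "r < 1" "\<And>z. z \<in> ?pre (cball 0 s) \<Longrightarrow> norm z \<le> r"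
        using compact_subset_ball_norm_bound by blast
      show "eventually (\<lambda>z. s < norm (f z)) ball_boundary"
        unfolding eventually_ball_boundary
        using r by (intro exI[of _ r]) (force simp: not_less[symmetric])
    next
      fix s :: real assume "1 < s"
      then show "eventually (\<lambda>z. norm (f z) < s) ball_boundary"
        using eventually_in_ball_ball_boundary
        by (rule_tac eventually_mono[OF eventually_in_ball_ball_boundary]) (use maps in force)
    qed
  qed
  show ?thesis using proper_iff compact_iff by blast
qed

lemma proper_holomorphic_ball_map_iff:
  "proper_holomorphic_ball_map f \<longleftrightarrow>
    holomorphic_map_on f (ball 0 1) \<and> (\<forall>z\<in>ball 0 1. norm (f z) < 1) \<and>
    ((\<lambda>z. norm (f z)) \<longlongrightarrow> 1) ball_boundary"
  unfolding proper_holomorphic_ball_map_def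
  using holomorphic_map_on_imp_continuous_on proper_map_ball_iff by blast

section \<open>Holomorphic maps of the disk\<close>

lemma norm_vec_1 [simp]: "norm (vec w :: 'a::real_normed_vector^1) = norm w"
  by (simp add: norm_vec_def)

lemma norm_nth_1 [simp]: "norm (z $ 1) = norm (z :: 'a::real_normed_vector^1)"
  by (simp add: norm_vec_def)

lemma bounded_linear_vec_1: "bounded_linear (vec :: 'a::real_normed_vector \<Rightarrow> 'a^1)"
  by (rule bounded_linear_intro[where K = 1]) (auto simp: vec_eq_iff)

text \<open>
  A complex linear map on \<open>complex^1\<close> is multiplication by a vector, so this reduces
  holomorphy to functions of one complex variable, where the closure rules apply.
\<close>

lemma holomorphic_map_on_disk_iff:
  fixes f :: "complex^1 \<Rightarrow> complex^'m"
  shows "holomorphic_map_on f (ball 0 1) \<longleftrightarrow> (\<forall>i. (\<lambda>w. f (vec w) $ i) holomorphic_on ball 0 1)"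
proof
  assume f: "holomorphic_map_on f (ball 0 1)"
  show "\<forall>i. (\<lambda>w. f (vec w) $ i) holomorphic_on ball 0 1"
  proof (intro allI)
    fix i
    have "(\<lambda>w. f (vec w) $ i) field_differentiable at w within ball 0 1" if w: "w \<in> ball 0 1" for w
    proof -
      have "vec w \<in> (ball 0 1 :: (complex^1) set)" using w by simp
      then obtain f' where f': "(f has_derivative f') (at (vec w) within ball 0 1)"
        "\<And>c v. f' (c *s v) = c *s f' v"
        using f unfolding holomorphic_map_on_def by blast
      have "((\<lambda>w. f (vec w)) has_derivative (\<lambda>h. f' (vec h))) (at w within ball 0 1)"
        by (rule has_derivative_in_compose[where g = f and f = vec])
           (auto intro!: has_derivative_subset[OF f'(1)] bounded_linear_imp_has_derivative bounded_linear_vec_1)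
      then have "((\<lambda>w. f (vec w) $ i) has_derivative (\<lambda>h. f' (vec h) $ i)) (at w within ball 0 1)"
        by (rule bounded_linear.has_derivative[OF bounded_linear_vec_nth])
      moreover have "f' (vec h) $ i = f' (vec 1) $ i * h" for h
      proof -
        have "vec h = h *s (vec 1 :: complex^1)" by (simp add: vec_eq_iff)
        then show ?thesis by (simp only: f'(2)) simp
      qed
      ultimately show ?thesis
        by (auto simp: field_differentiable_def has_field_derivative_def)
    qed
    then show "(\<lambda>w. f (vec w) $ i) holomorphic_on ball 0 1"
      by (simp add: holomorphic_on_def)
  qed
next
  assume h: "\<forall>i. (\<lambda>w. f (vec w) $ i) holomorphic_on ball 0 1"
  show "holomorphic_map_on f (ball 0 1)"
    unfolding holomorphic_map_on_def
  proof
    fix z :: "complex^1" assume z: "z \<in> ball 0 1"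
    define w where "w = z $ 1"
    have w: "w \<in> ball 0 1" using z by (simp add: w_def)
    have "\<exists>D. ((\<lambda>w. f (vec w) $ i) has_field_derivative D) (at w)" for i
      using h w by (metis field_differentiable_def holomorphic_on_imp_differentiable_at open_ball)
    then obtain D where D: "\<And>i. ((\<lambda>w. f (vec w) $ i) has_field_derivative D i) (at w)"
      by metis
    have "((\<lambda>z. f (vec (z $ 1)) $ i) has_derivative (\<lambda>h. D i * h $ 1)) (at z)" for i
      by (rule has_derivative_compose[where g = "\<lambda>w. f (vec w) $ i" and f = "\<lambda>z. z $ 1"])
         (use D[of i] in \<open>auto simp: w_def has_field_derivative_def
             intro!: bounded_linear_imp_has_derivative bounded_linear_vec_nth\<close>)
    then have "(f has_derivative (\<lambda>h. \<chi> i. D i * h $ 1)) (at z)"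
      by (subst has_derivative_componentwise_within)
         (auto simp: Basis_vec_def inner_axis intro!: has_derivative_inner_left)
    then have "(f has_derivative (\<lambda>h. \<chi> i. D i * h $ 1)) (at z within ball 0 1)"
      by (simp add: has_derivative_at_withinI)
    then show "\<exists>f'. (f has_derivative f') (at z within ball 0 1) \<and> (\<forall>c v. f' (c *s v) = c *s f' v)"
      by (intro exI conjI) (auto simp: vec_eq_iff algebra_simps)
  qed
qed

lemma norm_vector_scalar_mult: "norm (c *s v) = cmod c * norm (v :: complex^'m)"
  by (simp add: norm_vec_def norm_mult L2_set_right_distrib)

lemma continuous_on_vector_scalar_mult [continuous_intros]:
  fixes f :: "'a::topological_space \<Rightarrow> complex^'m"
  assumes "continuous_on S c" "continuous_on S f"
  shows "continuous_on S (\<lambda>x. c x *s f x)"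
  unfolding vector_scalar_mult_def by (intro continuous_intros assms)

section \<open>Disk automorphisms and their degeneration\<close>

definition disk_moebius :: "complex \<Rightarrow> complex \<Rightarrow> complex"
  where "disk_moebius a w = (w + a) / (1 + cnj a * w)"

lemma disk_moebius_0 [simp]: "disk_moebius 0 w = w"
  by (simp add: disk_moebius_def)

lemma disk_moebius_denom_nonzero:
  assumes "cmod a \<le> 1" "cmod w < 1"
  shows "1 + cnj a * w \<noteq> 0"
proof
  assume "1 + cnj a * w = 0"
  then have "cmod (cnj a * w) = 1" by (metis add_eq_0_iff norm_minus_cancel norm_one)
  moreover have "cmod a * cmod w \<le> 1 * cmod w" using assms by (intro mult_right_mono) auto
  ultimately show False using assms(2) by (simp add: norm_mult)
qed

text \<open>
  For a parameter on the circle numerator and denominator are proportional. The families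
  \<open>t \<mapsto> disk_moebius (t * \<zeta>)\<close> therefore end in a constant map.
\<close>

lemma disk_moebius_unimodular:
  assumes "cmod a = 1" "cmod w < 1"
  shows "disk_moebius a w = a"
proof -
  have "a * cnj a = 1"
    using assms(1) by (simp add: complex_norm_square[symmetric])
  then have "a * (1 + cnj a * w) = w + a"
    by (simp only: distrib_left mult.assoc[symmetric]) simp
  then show ?thesis
    using disk_moebius_denom_nonzero[of a w] assms by (simp add: disk_moebius_def field_simps)
qed

lemma one_minus_norm_disk_moebius_squared:
  assumes "cmod a \<le> 1" "cmod w < 1"
  shows "1 - (cmod (disk_moebius a w))\<^sup>2 =
    (1 - (cmod a)\<^sup>2) * (1 - (cmod w)\<^sup>2) / (cmod (1 + cnj a * w))\<^sup>2"
proof -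
  have "(cmod (1 + cnj a * w))\<^sup>2 - (cmod (w + a))\<^sup>2 = (1 - (cmod a)\<^sup>2) * (1 - (cmod w)\<^sup>2)"
    unfolding cmod_power2 by (simp add: power2_eq_square algebra_simps)
  moreover have "cmod (1 + cnj a * w) \<noteq> 0"
    using disk_moebius_denom_nonzero[OF assms] by simp
  ultimately show ?thesis
    by (simp add: disk_moebius_def norm_divide power_divide eq_divide_eq left_diff_distrib)
qed

lemma disk_moebius_in_disk:
  assumes "cmod a < 1" "cmod w < 1"
  shows "cmod (disk_moebius a w) < 1"
proof -
  have "0 < 1 - (cmod (disk_moebius a w))\<^sup>2"
    using assms disk_moebius_denom_nonzero[of a w]
    by (subst one_minus_norm_disk_moebius_squared)
       (auto intro!: divide_pos_pos mult_pos_pos simp: power_less_one_iff abs_square_less_1)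
  then show ?thesis by (simp add: abs_square_less_1)
qed

text \<open>
  The denominator is bounded below by \<open>1 - cmod a\<close>, so the formula for
  \<open>1 - (cmod (disk_moebius a w))\<^sup>2\<close> bounds it by a multiple of \<open>1 - (cmod w)\<^sup>2\<close>.
\<close>

lemma tendsto_norm_disk_moebius:
  assumes "cmod a < 1"
  shows "((\<lambda>w. cmod (disk_moebius a w)) \<longlongrightarrow> 1) ball_boundary"
proof -
  have "((\<lambda>w. (1 - (cmod w)\<^sup>2) / (1 - cmod a)\<^sup>2) \<longlongrightarrow> (1 - 1\<^sup>2) / (1 - cmod a)\<^sup>2) ball_boundary"
    using assms by (intro tendsto_intros tendsto_norm_ball_boundary) auto
  then have lim: "((\<lambda>w. (1 - (cmod w)\<^sup>2) / (1 - cmod a)\<^sup>2) \<longlongrightarrow> 0) ball_boundary"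
    by simp
  have bounds: "0 \<le> 1 - (cmod (disk_moebius a w))\<^sup>2 \<and>
      1 - (cmod (disk_moebius a w))\<^sup>2 \<le> (1 - (cmod w)\<^sup>2) / (1 - cmod a)\<^sup>2"
    if w: "w \<in> ball 0 1" for w
  proof -
    have "cmod a * cmod w \<le> cmod a" using w by (simp add: mult_left_le)
    then have "1 - cmod a \<le> cmod (1 + cnj a * w)"
      using norm_diff_ineq[of 1 "cnj a * w"] by (simp add: norm_mult)
    then have "(1 - cmod a)\<^sup>2 \<le> (cmod (1 + cnj a * w))\<^sup>2"
      using assms by (intro power_mono) auto
    moreover have "(1 - (cmod a)\<^sup>2) * (1 - (cmod w)\<^sup>2) \<le> 1 - (cmod w)\<^sup>2"
      using w assms by (intro mult_left_le_one_le) (auto simp: power_le_one_iff)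
    moreover have "0 \<le> (1 - (cmod w)\<^sup>2)" using w by (simp add: power_le_one_iff)
    ultimately have "1 - (cmod (disk_moebius a w))\<^sup>2 \<le> (1 - (cmod w)\<^sup>2) / (1 - cmod a)\<^sup>2"
      using w assms by (subst one_minus_norm_disk_moebius_squared) (auto intro!: frac_le)
    moreover have "(cmod (disk_moebius a w))\<^sup>2 \<le> 1"
      using disk_moebius_in_disk[OF assms, of w] w by (simp add: power_le_one_iff)
    ultimately show ?thesis by simp
  qed
  have "((\<lambda>w. 1 - (cmod (disk_moebius a w))\<^sup>2) \<longlongrightarrow> 0) ball_boundary"
    by (rule tendsto_sandwich[OF _ _ tendsto_const lim];
        rule eventually_mono[OF eventually_in_ball_ball_boundary]) (use bounds in auto)
  then have "((\<lambda>w. sqrt (1 - (1 - (cmod (disk_moebius a w))\<^sup>2))) \<longlongrightarrow> sqrt (1 - 0)) ball_boundary"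
    by (intro tendsto_intros)
  then show ?thesis by simp
qed

lemma filterlim_disk_moebius_ball_boundary:
  assumes "cmod a < 1"
  shows "filterlim (disk_moebius a) ball_boundary ball_boundary"
  by (rule filterlim_ball_boundary[OF tendsto_norm_disk_moebius[OF assms]])
     (rule eventually_mono[OF eventually_in_ball_ball_boundary], use disk_moebius_in_disk assms in auto)

lemma holomorphic_disk_moebius:
  assumes "cmod a \<le> 1"
  shows "disk_moebius a holomorphic_on ball 0 1"
  unfolding disk_moebius_def
  using disk_moebius_denom_nonzero[OF assms] by (intro holomorphic_intros) auto

text \<open>
  Continuity holds jointly in parameter and argument up to and including parameters on the
  circle: this is the locally uniform convergence of the automorphisms to a constant.
\<close>

lemma continuous_on_disk_moebius [continuous_intros]:
  assumes "continuous_on S a" "continuous_on S w"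
    "\<And>x. x \<in> S \<Longrightarrow> cmod (a x) \<le> 1" "\<And>x. x \<in> S \<Longrightarrow> cmod (w x) < 1"
  shows "continuous_on S (\<lambda>x. disk_moebius (a x) (w x))"
  unfolding disk_moebius_def
  using disk_moebius_denom_nonzero assms by (intro continuous_intros) auto

section \<open>Homotopies through proper holomorphic maps\<close>

lemma holomorphic_map_on_cong:
  assumes "\<And>z. z \<in> S \<Longrightarrow> f z = g z"
  shows "holomorphic_map_on f S \<longleftrightarrow> holomorphic_map_on g S"
proof -
  have "(f has_derivative f') (at z within S) \<longleftrightarrow> (g has_derivative f') (at z within S)"
    if "z \<in> S" for z f'
    using has_derivative_transform[OF that, of f g] has_derivative_transform[OF that, of g f] assms
    by auto
  then show ?thesis
    by (simp add: holomorphic_map_on_def cong: ball_cong)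
qed

lemma proper_holomorphic_ball_map_cong:
  assumes "\<And>z. z \<in> ball 0 1 \<Longrightarrow> f z = g z"
  shows "proper_holomorphic_ball_map f \<longleftrightarrow> proper_holomorphic_ball_map g"
proof -
  have "((\<lambda>z. norm (f z)) \<longlongrightarrow> 1) ball_boundary \<longleftrightarrow> ((\<lambda>z. norm (g z)) \<longlongrightarrow> 1) ball_boundary"
    by (rule tendsto_cong, rule eventually_mono[OF eventually_in_ball_ball_boundary])
       (simp add: assms)
  moreover have "(\<forall>z\<in>ball 0 1. norm (f z) < 1) \<longleftrightarrow> (\<forall>z\<in>ball 0 1. norm (g z) < 1)"
    using assms by simp
  ultimately show ?thesis
    by (simp only: proper_holomorphic_ball_map_iff holomorphic_map_on_cong[OF assms])
qed

text \<open>
  An instance of the general notion of homotopy, from which it inherits symmetry and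
  transitivity. The codomain may be the whole space because proper maps of balls map the ball
  into the ball anyway.
\<close>

abbreviation proper_homotopic ::
    "(complex^'n \<Rightarrow> complex^'m) \<Rightarrow> (complex^'n \<Rightarrow> complex^'m) \<Rightarrow> bool"
  where "proper_homotopic \<equiv>
    homotopic_with_canon proper_holomorphic_ball_map (ball 0 1) UNIV"

text \<open>
  \<open>homotopic_with\<close> asks for end maps that agree everywhere; here agreement on the ball
  suffices since properness depends on the values there alone.
\<close>

lemma proper_homotopicI:
  fixes H :: "real \<Rightarrow> complex^'n \<Rightarrow> complex^'m"
  assumes "continuous_on ({0..1} \<times> ball 0 1) (\<lambda>(t, z). H t z)"
    and "\<And>t. 0 \<le> t \<Longrightarrow> t \<le> 1 \<Longrightarrow> proper_holomorphic_ball_map (H t)"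
    and "\<And>z. z \<in> ball 0 1 \<Longrightarrow> f z = H 0 z" "\<And>z. z \<in> ball 0 1 \<Longrightarrow> g z = H 1 z"
  shows "proper_homotopic f g"
proof (rule homotopic_with_eq)
  show "proper_homotopic (H 0) (H 1)"
    unfolding homotopic_with_def
    using assms(1,2) by (intro exI[of _ "\<lambda>(t, z). H t z"]) auto
  fix h k :: "complex^'n \<Rightarrow> complex^'m"
  assume "\<And>z. z \<in> topspace (top_of_set (ball 0 1)) \<Longrightarrow> h z = k z"
  then show "proper_holomorphic_ball_map h \<longleftrightarrow> proper_holomorphic_ball_map k"
    by (intro proper_holomorphic_ball_map_cong) auto
qed (use assms(3,4) in auto)

lemma proper_homotopic_imp_homotopic_in_target:
  fixes f g :: "complex^'n \<Rightarrow> complex^'m"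
  assumes "proper_homotopic f g"
  shows "homotopic_in_target TYPE('m) f g"
proof -
  obtain h where cont: "continuous_on ({0..1} \<times> ball 0 1) h"
    and ends: "\<And>z. h (0, z) = f z" "\<And>z. h (1, z) = g z"
    and proper: "\<And>t. t \<in> {0..1::real} \<Longrightarrow> proper_holomorphic_ball_map (\<lambda>z. h (t, z))"
    using assms unfolding homotopic_with_def by auto
  have "continuous_on (ball 0 1 \<times> {0..1}) (\<lambda>(z, t). h (t, z))"
    unfolding case_prod_beta
    by (rule continuous_on_compose2[OF cont]) (auto intro!: continuous_intros)
  then show ?thesis
    unfolding homotopic_in_target_def
    using ends proper by (auto intro!: exI[of _ "\<lambda>t z. h (t, z)"])
qed

lemma filterlim_nth_1_ball_boundary:
  "filterlim (\<lambda>z :: complex^1. z $ 1) ball_boundary ball_boundary"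
  by (rule filterlim_ball_boundary)
     (use tendsto_norm_ball_boundary eventually_in_ball_ball_boundary in auto)

lemma filterlim_vec_ball_boundary:
  "filterlim (vec :: complex \<Rightarrow> complex^1) ball_boundary ball_boundary"
  by (rule filterlim_ball_boundary)
     (use tendsto_norm_ball_boundary eventually_in_ball_ball_boundary in auto)

text \<open>
  Only the product has to be smaller than one in norm: the vector factor may be a constant of
  norm one, as in the linear maps at which the homotopies below end.
\<close>

lemma proper_holomorphic_disk_map_scale:
  fixes f :: "complex^1 \<Rightarrow> complex^'m"
  assumes f: "holomorphic_map_on f (ball 0 1)" "((\<lambda>z. norm (f z)) \<longlongrightarrow> 1) ball_boundary"
    and \<phi>: "\<phi> holomorphic_on ball 0 1" "((\<lambda>w. cmod (\<phi> w)) \<longlongrightarrow> 1) ball_boundary"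
    and less: "\<And>z. z \<in> ball 0 1 \<Longrightarrow> cmod (\<phi> (z $ 1)) * norm (f z) < 1"
  shows "proper_holomorphic_ball_map (\<lambda>z. \<phi> (z $ 1) *s f z)"
  unfolding proper_holomorphic_ball_map_iff
proof (intro conjI)
  show "holomorphic_map_on (\<lambda>z. \<phi> (z $ 1) *s f z) (ball 0 1)"
    using f(1) \<phi>(1) by (auto simp: holomorphic_map_on_disk_iff intro!: holomorphic_intros)
  show "\<forall>z\<in>ball 0 1. norm (\<phi> (z $ 1) *s f z) < 1"
    using less by (auto simp: norm_vector_scalar_mult)
  have "((\<lambda>z :: complex^1. cmod (\<phi> (z $ 1))) \<longlongrightarrow> 1) ball_boundary"
    by (rule filterlim_compose[OF \<phi>(2) filterlim_nth_1_ball_boundary])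
  from tendsto_mult[OF this f(2)]
  show "((\<lambda>z. norm (\<phi> (z $ 1) *s f z)) \<longlongrightarrow> 1) ball_boundary"
    by (simp add: norm_vector_scalar_mult)
qed

lemma holomorphic_map_on_disk_compose:
  fixes f :: "complex^1 \<Rightarrow> complex^'m"
  assumes "holomorphic_map_on f (ball 0 1)" "\<phi> holomorphic_on ball 0 1" "\<phi> ` ball 0 1 \<subseteq> ball 0 1"
  shows "holomorphic_map_on (\<lambda>z :: complex^1. f (vec (\<phi> (z $ 1)))) (ball 0 1)"
  using assms holomorphic_on_compose_gen[of \<phi> "ball 0 1" _ "ball 0 1"]
  by (auto simp: holomorphic_map_on_disk_iff o_def)

lemma holomorphic_map_on_disk_const: "holomorphic_map_on (\<lambda>z :: complex^1. u) (ball 0 1)"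
  by (simp add: holomorphic_map_on_disk_iff)

section \<open>Contracting a rational map to a linear one\<close>

text \<open>
  The scalar factor runs through disk automorphisms from the identity to the constant \<open>1\<close>.
\<close>

lemma proper_homotopic_times_coordinate:
  fixes F :: "complex^1 \<Rightarrow> complex^'m"
  assumes F: "proper_holomorphic_ball_map F"
  shows "proper_homotopic (\<lambda>z. z $ 1 *s F z) F"
proof (rule proper_homotopicI[where H = "\<lambda>t z. disk_moebius (of_real t) (z $ 1) *s F z"])
  have holo: "holomorphic_map_on F (ball 0 1)" and maps: "\<And>z. z \<in> ball 0 1 \<Longrightarrow> norm (F z) < 1"
    and lim: "((\<lambda>z. norm (F z)) \<longlongrightarrow> 1) ball_boundary"
    using F by (auto simp: proper_holomorphic_ball_map_iff)
  show "continuous_on ({0..1} \<times> ball 0 1) (\<lambda>(t, z). disk_moebius (of_real t) (z $ 1) *s F z)"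
    unfolding case_prod_beta
    by (intro continuous_intros continuous_on_compose2[OF holomorphic_map_on_imp_continuous_on[OF holo]]) auto
  fix t :: real assume t: "0 \<le> t" "t \<le> 1"
  show "proper_holomorphic_ball_map (\<lambda>z. disk_moebius (of_real t) (z $ 1) *s F z)"
  proof (cases "t = 1")
    case True
    then show ?thesis
      using F proper_holomorphic_ball_map_cong[of F "\<lambda>z. disk_moebius (of_real t) (z $ 1) *s F z"]
      by (simp add: disk_moebius_unimodular)
  next
    case False
    then have t1: "cmod (of_real t) < 1" using t by simp
    show ?thesis
    proof (rule proper_holomorphic_disk_map_scale[OF holo lim])
      show "((\<lambda>w. cmod (disk_moebius (of_real t) w)) \<longlongrightarrow> 1) ball_boundary"
        using t1 by (rule tendsto_norm_disk_moebius)
      fix z :: "complex^1" assume "z \<in> ball 0 1"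
      then show "cmod (disk_moebius (of_real t) (z $ 1)) * norm (F z) < 1"
        using maps[of z] disk_moebius_in_disk[OF t1, of "z $ 1"]
          mult_strict_mono[of "cmod (disk_moebius (of_real t) (z $ 1))" 1 "norm (F z)" 1] by simp
    qed (use t1 holomorphic_disk_moebius in auto)
  qed
qed (auto simp: disk_moebius_unimodular)

lemma complex_polynomial_function_continuous_on:
  "complex_polynomial_function p \<Longrightarrow> continuous_on S p"
  by (induction rule: complex_polynomial_function.induct) (auto intro!: continuous_intros)

lemma complex_polynomial_function_disk:
  fixes q :: "complex^1 \<Rightarrow> complex"
  assumes "complex_polynomial_function q"
  shows "\<exists>Q. \<forall>w. q (vec w) = poly Q w"
  using assms
proof induction
  case (const c) show ?case by (intro exI[of _ "[:c:]"]) simp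
next
  case (coord i) show ?case by (intro exI[of _ "[:0, 1:]"]) simp
next
  case (add p q) then show ?case by (metis poly_add)
next
  case (mult p q) then show ?case by (metis poly_mult)
qed

text \<open>
  A nonzero polynomial in one variable has finitely many zeros, and the circle is infinite.
\<close>

lemma complex_polynomial_function_nonzero_on_circle:
  fixes q :: "complex^1 \<Rightarrow> complex"
  assumes "complex_polynomial_function q" "q z \<noteq> 0"
  obtains \<zeta> where "cmod \<zeta> = 1" "q (vec \<zeta>) \<noteq> 0"
proof -
  obtain Q where Q: "\<And>w. q (vec w) = poly Q w"
    using complex_polynomial_function_disk[OF assms(1)] by blast
  then have "Q \<noteq> 0" using assms(2) by (metis poly_0 vector_one_nth)
  then have "finite {w. poly Q w = 0}" by (rule poly_roots_finite)
  moreover have "infinite (sphere (0 :: complex) 1)"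
  proof -
    have "1 \<in> sphere (0 :: complex) 1" "- 1 \<in> sphere (0 :: complex) 1" "(1 :: complex) \<noteq> - 1" by auto
    moreover have "connected (sphere (0 :: complex) 1)" by (rule connected_sphere) simp
    ultimately show ?thesis by (metis connected_uncountable countable_finite)
  qed
  ultimately obtain \<zeta> where "\<zeta> \<in> sphere 0 1" "poly Q \<zeta> \<noteq> 0"
    by (metis (mono_tags, lifting) finite_subset mem_Collect_eq subsetI)
  then show thesis using that[of \<zeta>] Q by simp
qed

lemma proper_holomorphic_ball_map_linear:
  fixes u :: "complex^'m"
  assumes "norm u = 1"
  shows "proper_holomorphic_ball_map (\<lambda>z :: complex^1. z $ 1 *s u)"
  by (rule proper_holomorphic_disk_map_scale[where \<phi> = "\<lambda>w. w"])
     (auto simp: assms holomorphic_map_on_disk_const tendsto_norm_ball_boundary)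

text \<open>
  Composing \<open>F\<close> with disk automorphisms whose parameter moves to a boundary point where \<open>F\<close> is
  continuous turns \<open>F\<close> into its boundary value at that point.
\<close>

lemma proper_homotopic_linear_limit:
  fixes F :: "complex^1 \<Rightarrow> complex^'m"
  assumes "rational_proper_ball_map F"
  obtains u where "norm u = 1" "proper_homotopic (\<lambda>z. z $ 1 *s F z) (\<lambda>z. z $ 1 *s u)"
proof -
  have F: "proper_holomorphic_ball_map F" and "rational_on_ball F"
    using assms by (auto simp: rational_proper_ball_map_def)
  then obtain p q where pq: "\<And>i. complex_polynomial_function (p i)" "complex_polynomial_function q"
      "\<And>z. z \<in> ball 0 1 \<Longrightarrow> q z \<noteq> 0" "\<And>z i. z \<in> ball 0 1 \<Longrightarrow> F z $ i = p i z / q z"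
    unfolding rational_on_ball_def by blast
  obtain \<zeta> where \<zeta>: "cmod \<zeta> = 1" "q (vec \<zeta>) \<noteq> 0"
    using complex_polynomial_function_nonzero_on_circle[OF pq(2) pq(3)[of 0]] by auto
  \<comment> \<open>The quotient of polynomials extends \<open>F\<close> continuously to the boundary point.\<close>
  define E where "E = (\<lambda>z. \<chi> i. p i z / q z)"
  have E_eq: "E z = F z" if "z \<in> ball 0 1" for z
    using pq(4)[OF that] by (simp add: E_def vec_eq_iff)
  have "proper_holomorphic_ball_map E"
    using F proper_holomorphic_ball_map_cong[of E F] E_eq by blast
  then have holo: "holomorphic_map_on E (ball 0 1)" and maps: "\<And>z. z \<in> ball 0 1 \<Longrightarrow> norm (E z) < 1"
    and lim: "((\<lambda>z. norm (E z)) \<longlongrightarrow> 1) ball_boundary"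
    by (auto simp: proper_holomorphic_ball_map_iff)
  have cont: "continuous_on (insert (vec \<zeta>) (ball 0 1)) E"
    unfolding E_def using pq \<zeta>
    by (intro continuous_on_vec_lambda continuous_on_divide
          complex_polynomial_function_continuous_on[OF pq(1)]
          complex_polynomial_function_continuous_on[OF pq(2)]) auto
  \<comment> \<open>Along the radius to that point, properness and continuity both determine the limit of
    the norm.\<close>
  define \<gamma> :: "real \<Rightarrow> complex^1" where "\<gamma> r = vec (of_real r * \<zeta>)" for r
  have \<gamma>_in: "eventually (\<lambda>r. \<gamma> r \<in> ball 0 1) (at_left 1)"
    using eventually_at_left_real[OF zero_less_one]
    by eventually_elim (auto simp: \<gamma>_def norm_mult \<zeta>)
  have "(\<gamma> \<longlongrightarrow> \<gamma> 1) (at_left 1)"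
    unfolding \<gamma>_def
    by (intro bounded_linear.tendsto[OF bounded_linear_vec_1] tendsto_intros)
  then have \<gamma>_lim: "(\<gamma> \<longlongrightarrow> vec \<zeta>) (at_left 1)" by (simp add: \<gamma>_def)
  have "((\<lambda>r. norm (E (\<gamma> r))) \<longlongrightarrow> norm (E (vec \<zeta>))) (at_left 1)"
    by (intro tendsto_norm continuous_on_tendsto_compose[OF cont \<gamma>_lim])
       (auto intro: eventually_mono[OF \<gamma>_in])
  moreover have "filterlim \<gamma> ball_boundary (at_left 1)"
    using tendsto_norm[OF \<gamma>_lim] \<gamma>_in \<zeta>(1) by (intro filterlim_ball_boundary) auto
  then have "((\<lambda>r. norm (E (\<gamma> r))) \<longlongrightarrow> 1) (at_left 1)"
    by (rule filterlim_compose[OF lim])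
  ultimately have norm_E: "norm (E (vec \<zeta>)) = 1"
    by (intro tendsto_unique[of "at_left (1::real)"]) auto
  have in_disk: "cmod (disk_moebius (of_real t * \<zeta>) (z $ 1)) < 1"
    if "0 \<le> t" "t < 1" "z \<in> ball 0 1" for t and z :: "complex^1"
    using that \<zeta>(1) by (intro disk_moebius_in_disk) (auto simp: norm_mult)
  have at_1: "disk_moebius \<zeta> (z $ 1) = \<zeta>" if "z \<in> ball 0 1" for z :: "complex^1"
    using that \<zeta>(1) by (intro disk_moebius_unimodular) auto
  have "proper_homotopic (\<lambda>z. z $ 1 *s F z) (\<lambda>z. z $ 1 *s E (vec \<zeta>))"
  proof (rule proper_homotopicI[where
        H = "\<lambda>t z. z $ 1 *s E (vec (disk_moebius (of_real t * \<zeta>) (z $ 1)))"])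
    \<comment> \<open>The argument of \<open>E\<close> is inside the disk for \<open>t < 1\<close> and is the boundary point for \<open>t = 1\<close>.\<close>
    have in_domain: "vec (disk_moebius (of_real t * \<zeta>) (z $ 1)) \<in> insert (vec \<zeta>) (ball 0 1 :: (complex^1) set)"
      if "0 \<le> t" "t \<le> 1" "z \<in> ball 0 1" for t and z :: "complex^1"
    proof (cases "t = 1")
      case True
      then show ?thesis using at_1[OF that(3)] by simp
    next
      case False
      then show ?thesis using in_disk[OF that(1) _ that(3)] that(2) by simp
    qed
    have "continuous_on ({0..1} \<times> ball 0 1)
        (\<lambda>x :: real \<times> (complex^1). disk_moebius (of_real (fst x) * \<zeta>) (snd x $ 1))"
    proof (rule continuous_on_disk_moebius)
      show "continuous_on ({0..1} \<times> ball 0 1) (\<lambda>x :: real \<times> (complex^1). of_real (fst x) * \<zeta>)"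
        by (intro continuous_intros)
      show "continuous_on ({0..1} \<times> ball 0 1) (\<lambda>x :: real \<times> (complex^1). snd x $ 1)"
        by (intro continuous_intros)
      fix x :: "real \<times> (complex^1)" assume x: "x \<in> {0..1} \<times> ball 0 1"
      show "cmod (of_real (fst x) * \<zeta>) \<le> 1"
        using x \<zeta>(1) by (simp add: norm_mult mem_Times_iff)
      show "cmod (snd x $ 1) < 1"
        using x by (simp add: mem_Times_iff)
    qed
    then have "continuous_on ({0..1} \<times> ball 0 1)
        (\<lambda>x :: real \<times> (complex^1). vec (disk_moebius (of_real (fst x) * \<zeta>) (snd x $ 1)) :: complex^1)"
      by (rule bounded_linear.continuous_on[OF bounded_linear_vec_1])
    then have "continuous_on ({0..1} \<times> ball 0 1)
        (\<lambda>x :: real \<times> (complex^1). E (vec (disk_moebius (of_real (fst x) * \<zeta>) (snd x $ 1))))"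
      by (rule continuous_on_compose2[OF cont]) (use in_domain in \<open>simp add: image_subset_iff\<close>)
    then show "continuous_on ({0..1} \<times> ball 0 1)
        (\<lambda>(t, z :: complex^1). z $ 1 *s E (vec (disk_moebius (of_real t * \<zeta>) (z $ 1))))"
      unfolding case_prod_beta
      by (intro continuous_on_vector_scalar_mult continuous_on_component continuous_on_snd continuous_on_id)
    fix t :: real assume t: "0 \<le> t" "t \<le> 1"
    show "proper_holomorphic_ball_map (\<lambda>z :: complex^1. z $ 1 *s E (vec (disk_moebius (of_real t * \<zeta>) (z $ 1))))"
    proof (cases "t = 1")
      case True
      have "proper_holomorphic_ball_map (\<lambda>z :: complex^1. z $ 1 *s E (vec (disk_moebius (of_real t * \<zeta>) (z $ 1)))) \<longleftrightarrow>
          proper_holomorphic_ball_map (\<lambda>z :: complex^1. z $ 1 *s E (vec \<zeta>))"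
        using True at_1 by (intro proper_holomorphic_ball_map_cong) simp
      then show ?thesis
        using proper_holomorphic_ball_map_linear[OF norm_E] by blast
    next
      case False
      then have t1: "cmod (of_real t * \<zeta>) < 1" using t \<zeta>(1) by (simp add: norm_mult)
      show ?thesis
      proof (rule proper_holomorphic_disk_map_scale[where \<phi> = "\<lambda>w. w"])
        show "holomorphic_map_on (\<lambda>z :: complex^1. E (vec (disk_moebius (of_real t * \<zeta>) (z $ 1)))) (ball 0 1)"
          using t1 disk_moebius_in_disk[OF t1]
          by (intro holomorphic_map_on_disk_compose holo holomorphic_disk_moebius) auto
        have "filterlim (\<lambda>z :: complex^1. vec (disk_moebius (of_real t * \<zeta>) (z $ 1)) :: complex^1)
            ball_boundary ball_boundary"
          by (rule filterlim_compose[OF filterlim_vec_ball_boundary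
                filterlim_compose[OF filterlim_disk_moebius_ball_boundary[OF t1]
                  filterlim_nth_1_ball_boundary]])
        then show "((\<lambda>z :: complex^1. norm (E (vec (disk_moebius (of_real t * \<zeta>) (z $ 1))))) \<longlongrightarrow> 1) ball_boundary"
          by (rule filterlim_compose[OF lim])
        fix z :: "complex^1" assume z: "z \<in> ball 0 1"
        then have "norm (E (vec (disk_moebius (of_real t * \<zeta>) (z $ 1)))) < 1"
          using disk_moebius_in_disk[OF t1, of "z $ 1"] by (intro maps) auto
        then show "cmod (z $ 1) * norm (E (vec (disk_moebius (of_real t * \<zeta>) (z $ 1)))) < 1"
          using z mult_strict_mono[of "cmod (z $ 1)" 1 _ 1] by simp
      qed (auto simp: tendsto_norm_ball_boundary)
    qed
  next
    fix z :: "complex^1" assume z: "z \<in> ball 0 1"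
    show "z $ 1 *s F z = z $ 1 *s E (vec (disk_moebius (of_real 0 * \<zeta>) (z $ 1)))"
      using E_eq[OF z] by simp
    show "z $ 1 *s E (vec \<zeta>) = z $ 1 *s E (vec (disk_moebius (of_real 1 * \<zeta>) (z $ 1)))"
      using at_1[OF z] by simp
  qed
  with norm_E show thesis by (rule that)
qed

section \<open>All rational proper maps are homotopic\<close>

text \<open>
  The unit sphere of \<open>complex^'m\<close> has real dimension at least one and is path connected.
\<close>

lemma proper_homotopic_linear:
  fixes u v :: "complex^'m"
  assumes "norm u = 1" "norm v = 1"
  shows "proper_homotopic (\<lambda>z :: complex^1. z $ 1 *s u) (\<lambda>z. z $ 1 *s v)"
proof -
  have "DIM(complex^'m) = CARD('m) * 2" by simp
  moreover have "CARD('m) > 0" by simp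
  ultimately have "2 \<le> DIM(complex^'m)" by linarith
  then have conn: "path_connected (sphere (0 :: complex^'m) 1)" by (rule path_connected_sphere)
  obtain \<gamma> where \<gamma>: "path \<gamma>" "path_image \<gamma> \<subseteq> sphere 0 1" "pathstart \<gamma> = u" "pathfinish \<gamma> = v"
    using conn[unfolded path_connected_def, rule_format, of u v] assms by auto
  show ?thesis
  proof (rule proper_homotopicI[where H = "\<lambda>t z. z $ 1 *s \<gamma> t"])
    have "continuous_on ({0..1} \<times> ball 0 1) (\<lambda>x :: real \<times> (complex^1). \<gamma> (fst x))"
      by (rule continuous_on_compose2[OF \<gamma>(1)[unfolded path_def] continuous_on_fst[OF continuous_on_id]])
         auto
    then show "continuous_on ({0..1} \<times> ball 0 1) (\<lambda>(t, z :: complex^1). z $ 1 *s \<gamma> t)"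
      unfolding case_prod_beta
      by (intro continuous_on_vector_scalar_mult continuous_on_component continuous_on_snd continuous_on_id)
    fix t :: real assume "0 \<le> t" "t \<le> 1"
    then have "\<gamma> t \<in> path_image \<gamma>" by (simp add: path_image_def)
    then have "norm (\<gamma> t) = 1" using \<gamma>(2) by auto
    then show "proper_holomorphic_ball_map (\<lambda>z :: complex^1. z $ 1 *s \<gamma> t)"
      by (rule proper_holomorphic_ball_map_linear)
  qed (use \<gamma>(3,4) in \<open>auto simp: pathstart_def pathfinish_def\<close>)
qed

lemma rational_proper_homotopic_to_linear:
  fixes F :: "complex^1 \<Rightarrow> complex^'m"
  assumes "rational_proper_ball_map F" "norm v = 1"
  shows "proper_homotopic F (\<lambda>z. z $ 1 *s v)"
proof -
  obtain u where u: "norm u = 1" "proper_homotopic (\<lambda>z. z $ 1 *s F z) (\<lambda>z. z $ 1 *s u)"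
    using proper_homotopic_linear_limit[OF assms(1)] by blast
  have "proper_homotopic F (\<lambda>z. z $ 1 *s F z)"
    using assms(1) unfolding rational_proper_ball_map_def
    by (intro homotopic_with_symD[OF proper_homotopic_times_coordinate]) simp
  moreover have "proper_homotopic (\<lambda>z :: complex^1. z $ 1 *s u) (\<lambda>z. z $ 1 *s v)"
    using u(1) assms(2) by (rule proper_homotopic_linear)
  ultimately show ?thesis
    using u(2) homotopic_with_trans by blast
qed

lemma rational_proper_ball_map_linear:
  fixes u :: "complex^'m"
  assumes "norm u = 1"
  shows "rational_proper_ball_map (\<lambda>z :: complex^1. z $ 1 *s u)"
proof -
  have "rational_on_ball (\<lambda>z :: complex^1. z $ 1 *s u)"
    unfolding rational_on_ball_def
    by (intro exI[of _ "\<lambda>i z. z $ 1 * u $ i"] exI[of _ "\<lambda>z. 1"])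
       (auto intro: complex_polynomial_function.intros)
  then show ?thesis
    using proper_holomorphic_ball_map_linear[OF assms] by (simp add: rational_proper_ball_map_def)
qed

theorem theorem5p1:
  assumes "CARD('N::finite) \<ge> 2"
  shows "(\<forall>(F :: complex^1 \<Rightarrow> complex^'N) (G :: complex^1 \<Rightarrow> complex^'N).
            rational_proper_ball_map F \<longrightarrow> rational_proper_ball_map G \<longrightarrow>
            homotopic_in_target TYPE('N) F G) \<and>
         num_homotopy_classes TYPE(1) TYPE('N) = 1"
proof
  have "norm (axis undefined 1 :: complex^'N) = 1" by (simp add: norm_axis_1)
  then obtain v :: "complex^'N" where v: "norm v = 1" by blast
  show homotopic: "\<forall>(F :: complex^1 \<Rightarrow> complex^'N) (G :: complex^1 \<Rightarrow> complex^'N).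
            rational_proper_ball_map F \<longrightarrow> rational_proper_ball_map G \<longrightarrow>
            homotopic_in_target TYPE('N) F G"
    by (meson homotopic_with_symD homotopic_with_trans proper_homotopic_imp_homotopic_in_target
        rational_proper_homotopic_to_linear v)
  have "rational_proper_ball_map (\<lambda>z :: complex^1. z $ 1 *s v)"
    using v by (rule rational_proper_ball_map_linear)
  then have "homotopy_classes TYPE(1) TYPE('N) = {{f. rational_proper_ball_map f}}"
    using homotopic by (auto simp: homotopy_classes_def quotient_def)
  then show "num_homotopy_classes TYPE(1) TYPE('N) = 1"
    by (simp add: num_homotopy_classes_def)
qed

end
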